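(* Let $\varepsilon\in(0,1)$. Suppose $\mathcal{P},\mathcal{P}^*$ are distributions over $[M]$, where $\mathcal{P}^*$ is known and satisfies $P^*(1)\le P^*(2)\le\cdots\le P^*(M)$, and we have \textsc{Cond} access to $\mathcal{P}$. Let $c_1,c_2$ be known constants with $\varepsilon\le c_1,c_2\le 1$. Then there is an algorithm that uses $O(\varepsilon^{-4}\log^6\varepsilon^{-1})$ queries to the \textsc{Cond} oracle of $\mathcal{P}$ such that, with probability at least $1-\varepsilon$, it finds a set $S\subseteq[M]$ with $P^*(S)\ge\frac13$ together with an estimate of $\sum_{i\in S}\min(c_1P(i),c_2P^*(i))$ that is accurate to within additive error $O(\varepsilon\log\varepsilon^{-1})$.
   Context: $P(i)=\Pr_{x\sim\mathcal{P}}(x=i)$, $P(S)=\sum_{i\in S}P(i)$, and similarly for $\mathcal{P}^*$. The \textsc{Cond} oracle of $\mathcal{P}$ takes $S\subseteq[M]$ and returns $i\in S$ with probability $P(i)/P(S)$, independently of previous calls. *)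

theory Defs
  imports "HOL-Probability.Probability"
begin

text \<open>
  Randomized adaptive algorithms with oracle access: well-founded trees that return a result,
  draw from an arbitrary discrete distribution (internal randomness), or submit a set to the
  oracle and continue depending on the reply.  Only oracle calls are counted, so the model is one
  of query complexity.
\<close>

datatype 'r cond_alg =
    Return 'r
  | Draw "'r cond_alg pmf"
  | Query "nat set" "nat \<Rightarrow> 'r cond_alg"

text \<open>
  The distribution of the result when each query \<open>S\<close> is answered by a fresh draw from \<open>Orc S\<close>;
  the nested \<open>bind_pmf\<close> expresses independence of previous calls.
\<close>

primrec run :: "(nat set \<Rightarrow> nat pmf) \<Rightarrow> 'r cond_alg \<Rightarrow> 'r pmf" where
  "run Orc (Return r) = return_pmf r"
| "run Orc (Draw p) = join_pmf (map_pmf (run Orc) p)"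
| "run Orc (Query S k) = bind_pmf (Orc S) (\<lambda>i. run Orc (k i))"

text \<open>
  Worst-case query bound: on every branch at most \<open>n\<close> queries are made, all of them to
  subsets of \<open>{1..M}\<close>.
\<close>

inductive queries_within :: "nat \<Rightarrow> nat \<Rightarrow> 'r cond_alg \<Rightarrow> bool" for M :: nat where
  "queries_within M n (Return r)"
| "(\<And>a. a \<in> set_pmf p \<Longrightarrow> queries_within M n a) \<Longrightarrow> queries_within M n (Draw p)"
| "S \<subseteq> {1..M} \<Longrightarrow> (\<And>i. queries_within M n (k i)) \<Longrightarrow> queries_within M (Suc n) (Query S k)"

text \<open>
  \<open>P(i) / P(S)\<close> is meaningless when \<open>P(S) = 0\<close>, and nothing is promised for such queries: the
  reply distribution is then arbitrary.  In particular this covers an oracle that replies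
  uniformly on \<open>S\<close> and one that reports failure (say by the reply \<open>0\<close>).
\<close>

definition is_cond_oracle :: "nat \<Rightarrow> nat pmf \<Rightarrow> (nat set \<Rightarrow> nat pmf) \<Rightarrow> bool" where
  "is_cond_oracle M P Orc \<longleftrightarrow>
     (\<forall>S \<subseteq> {1..M}. measure_pmf.prob P S > 0 \<longrightarrow>
        (\<forall>i\<in>S. pmf (Orc S) i = pmf P i / measure_pmf.prob P S))"

end

theory Submission
  imports Defs
begin

text \<open>
  Take \<open>S = {1..M}\<close> and write \<open>Q\<close> for the known distribution.  The target is the \<open>Q\<close>-average of
  \<open>min (c1 P(y) / Q(y)) c2\<close>, so it suffices to estimate the ratio \<open>P(y) / Q(y)\<close> for random \<open>y\<close>.
  Partition the domain into \<open>N = O(1 / Q(y))\<close> cells, one of them \<open>{y}\<close>, and let a cell \<open>G\<close> win its duel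
  against \<open>y\<close> if a query to \<open>{y} \<union> G\<close> is not answered by \<open>y\<close>.  The winning probability \<open>a(G)\<close>
  satisfies \<open>P(y) a(G) = P(G) (1 - a(G))\<close>; summing over all cells gives \<open>B = P(y) N A\<close>, where \<open>A\<close> is the
  probability that a uniformly random cell wins and \<open>B\<close> the probability that the cell of a sample
  of \<open>P\<close> loses.  Estimating \<open>A\<close> and \<open>B\<close> from \<open>n\<close> samples each gives the truncated ratio with mean
  error \<open>O(1 / sqrt (n A))\<close>.  Now \<open>A\<close> is at least a constant times the \<open>Q\<close>-mass of the elements up
  to \<open>y\<close> whose ratio is at least half of that of \<open>y\<close>.  Averaging over \<open>y\<close>, each of the
  \<open>O(ln (1 / \<epsilon>))\<close> dyadic classes of ratios between \<open>\<epsilon>\<close> and \<open>1 / \<epsilon>\<close> thus contributes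
  \<open>O(1 / sqrt n)\<close> to the bias, and the other elements contribute \<open>O(\<epsilon>)\<close>.
\<close>

subsection \<open>Adaptive algorithms and binomial moments\<close>

primrec bind_alg :: "'r cond_alg \<Rightarrow> ('r \<Rightarrow> 's cond_alg) \<Rightarrow> 's cond_alg" where
  "bind_alg (Return r) f = f r"
| "bind_alg (Draw p) f = Draw (map_pmf (\<lambda>a. bind_alg a f) p)"
| "bind_alg (Query S k) f = Query S (\<lambda>i. bind_alg (k i) f)"

primrec tally :: "nat \<Rightarrow> bool cond_alg \<Rightarrow> nat cond_alg" where
  "tally 0 a = Return 0"
| "tally (Suc n) a =
     bind_alg a (\<lambda>b. bind_alg (tally n a) (\<lambda>k. Return (if b then Suc k else k)))"

lemma run_Draw_map: "run Orc (Draw (map_pmf f p)) = bind_pmf p (\<lambda>x. run Orc (f x))"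
  by (simp add: bind_eq_join_pmf map_pmf_comp)

lemma run_bind_alg: "run Orc (bind_alg a f) = bind_pmf (run Orc a) (\<lambda>r. run Orc (f r))"
proof (induction a)
  case (Draw p)
  have "run Orc (bind_alg (Draw p) f) = bind_pmf p (\<lambda>a. bind_pmf (run Orc a) (\<lambda>r. run Orc (f r)))"
    using Draw by (simp only: bind_alg.simps run_Draw_map cong: bind_pmf_cong)
  also have "\<dots> = bind_pmf (run Orc (Draw p)) (\<lambda>r. run Orc (f r))"
    by (simp flip: bind_eq_join_pmf add: bind_assoc_pmf)
  finally show ?case .
qed (auto simp: bind_return_pmf bind_assoc_pmf)

lemma bool_pmf_eq_bernoulli: "(p :: bool pmf) = bernoulli_pmf (pmf p True)"
proof (rule pmf_eqI)
  fix b
  have "(\<Sum>b\<in>UNIV. pmf p b) = 1"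
    by (rule sum_pmf_eq_1) auto
  then have "pmf p False = 1 - pmf p True"
    by (simp add: UNIV_bool)
  then show "pmf p b = pmf (bernoulli_pmf (pmf p True)) b"
    by (cases b) (auto simp: pmf_le_1)
qed

lemma run_tally: "run Orc (tally n a) = binomial_pmf n (pmf (run Orc a) True)"
proof (induction n)
  case 0
  then show ?case by (simp add: binomial_pmf_0 pmf_le_1)
next
  case (Suc n)
  then show ?case
    by (subst binomial_pmf_Suc)
      (auto simp: run_bind_alg pmf_le_1 simp flip: bool_pmf_eq_bernoulli intro!: bind_pmf_cong)
qed

lemma queries_within_mono: "queries_within M n a \<Longrightarrow> n \<le> n' \<Longrightarrow> queries_within M n' a"
proof (induction arbitrary: n' rule: queries_within.induct)
  case (3 S n k)
  then obtain l where "n' = Suc l" "n \<le> l" by (cases n') auto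
  with 3 show ?case by (auto intro: queries_within.intros simp del: One_nat_def)
qed (auto intro: queries_within.intros)

lemma queries_within_bind_alg:
  assumes "queries_within M n a" "\<And>r. queries_within M m (f r)"
  shows "queries_within M (n + m) (bind_alg a f)"
  using assms(1)
proof (induction rule: queries_within.induct)
  case (1 n r)
  show ?case using queries_within_mono[OF assms(2), of "n + m"] by simp
qed (auto intro!: queries_within.intros simp del: One_nat_def)

lemma queries_within_tally:
  assumes "queries_within M n a"
  shows "queries_within M (k * n) (tally k a)"
proof (induction k)
  case (Suc k)
  have "queries_within M (n + (k * n + 0)) (tally (Suc k) a)"
    unfolding tally.simps
    by (intro queries_within_bind_alg Suc.IH assms queries_within.intros(1))
  then show ?case by simp
qed (auto intro: queries_within.intros)

section \<open>Moments of the binomial distribution\<close>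

lemma integrable_binomial_pmf [simp]:
  assumes "p \<in> {0..1}"
  shows "integrable (measure_pmf (binomial_pmf n p)) (f :: nat \<Rightarrow> real)"
  by (rule integrable_measure_pmf_finite) (use assms in \<open>auto simp: set_pmf_binomial_eq\<close>)

lemma expectation_binomial_pmf:
  assumes "p \<in> {0..1}"
  shows "measure_pmf.expectation (binomial_pmf n p) (f :: nat \<Rightarrow> real) =
    (\<Sum>k\<le>n. f k * (real (n choose k) * p ^ k * (1 - p) ^ (n - k)))"
  by (subst integral_measure_pmf_real[of "{..n}"])
    (use assms in \<open>auto simp: set_pmf_binomial_eq split: if_splits\<close>)

lemma expectation_binomial_pmf_Suc:
  assumes "p \<in> {0..1}"
  shows "measure_pmf.expectation (binomial_pmf (Suc n) p) (f :: nat \<Rightarrow> real) =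
    p * measure_pmf.expectation (binomial_pmf n p) (\<lambda>k. f (Suc k)) +
    (1 - p) * measure_pmf.expectation (binomial_pmf n p) f"
proof -
  have fin: "finite (set_pmf (binomial_pmf n p))" for n
    using assms by (auto simp: set_pmf_binomial_eq)
  have "binomial_pmf (Suc n) p =
      bind_pmf (bernoulli_pmf p) (\<lambda>b. map_pmf (\<lambda>k. if b then Suc k else k) (binomial_pmf n p))"
    using assms by (auto simp: binomial_pmf_Suc map_pmf_def intro!: bind_pmf_cong)
  also have "measure_pmf.expectation \<dots> f = (\<Sum>b\<in>UNIV. pmf (bernoulli_pmf p) b *
      measure_pmf.expectation (map_pmf (\<lambda>k. if b then Suc k else k) (binomial_pmf n p)) f)"
    by (subst pmf_expectation_bind[where A = UNIV]) (auto simp: fin)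
  finally show ?thesis
    using assms by (simp add: UNIV_bool)
qed

lemma mean_binomial_pmf:
  assumes "p \<in> {0..1}"
  shows "measure_pmf.expectation (binomial_pmf n p) real = real n * p"
  by (induction n) (use assms in \<open>simp_all add: binomial_pmf_0 expectation_binomial_pmf_Suc algebra_simps\<close>)

lemma second_moment_binomial_pmf:
  assumes "p \<in> {0..1}"
  shows "measure_pmf.expectation (binomial_pmf n p) (\<lambda>k. (real k)\<^sup>2) =
    real n * p * (1 - p) + (real n * p)\<^sup>2"
proof (induction n)
  case (Suc n)
  have "measure_pmf.expectation (binomial_pmf n p) (\<lambda>k. (real (Suc k))\<^sup>2) =
     measure_pmf.expectation (binomial_pmf n p) (\<lambda>k. (real k)\<^sup>2 + 2 * real k + 1)"
    by (simp add: power2_eq_square algebra_simps)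
  also have "\<dots> = real n * p * (1 - p) + (real n * p)\<^sup>2 + 2 * (real n * p) + 1"
    using assms Suc by (simp add: mean_binomial_pmf)
  finally show ?case
    using assms Suc by (simp add: expectation_binomial_pmf_Suc) (simp add: power2_eq_square algebra_simps)
qed (use assms in \<open>simp add: binomial_pmf_0\<close>)

text \<open>Jensen: the variance of \<open>?D\<close> is nonnegative, and the second moment of
  \<open>?D\<close> is \<open>p * (1 - p) / n\<close>. The factor \<open>p\<close> under the root
  matters because winning probabilities can be tiny.\<close>

lemma mean_deviation_binomial_pmf:
  assumes p: "p \<in> {0..1}" and "n > 0"
  shows "measure_pmf.expectation (binomial_pmf n p) (\<lambda>k. \<bar>real k / real n - p\<bar>) \<le> sqrt (p / real n)"
proof -
  let ?E = "measure_pmf.expectation (binomial_pmf n p)"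
  let ?D = "\<lambda>k. \<bar>real k / real n - p\<bar>"
  have "0 \<le> ?E (\<lambda>k. (?D k - ?E ?D)\<^sup>2)"
    by (rule Bochner_Integration.integral_nonneg) auto
  also have "\<dots> = ?E (\<lambda>k. (?D k)\<^sup>2 - 2 * ?E ?D * ?D k + (?E ?D)\<^sup>2)"
    by (simp only: power2_diff mult.commute mult.left_commute) (simp add: algebra_simps)
  also have "\<dots> = ?E (\<lambda>k. (?D k)\<^sup>2) - (?E ?D)\<^sup>2"
    using p by (simp del: power2_abs add: power2_eq_square)
  also have "?E (\<lambda>k. (?D k)\<^sup>2) = ?E (\<lambda>k. (real k)\<^sup>2 / (real n)\<^sup>2 - 2 * p / real n * real k + p\<^sup>2)"
    by (intro Bochner_Integration.integral_cong) (auto simp: power2_diff power_divide)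
  also have "\<dots> = p * (1 - p) / real n"
    using p \<open>n > 0\<close> by (simp add: mean_binomial_pmf second_moment_binomial_pmf)
      (simp add: field_simps power2_eq_square)
  also have "\<dots> \<le> p / real n"
    using p \<open>n > 0\<close> by (intro divide_right_mono) (auto intro: mult_left_le)
  finally have "(?E ?D)\<^sup>2 \<le> p / real n" by simp
  then show ?thesis by (simp add: real_le_rsqrt)
qed

text \<open>Since \<open>(n choose k) / (k + 1) = (n + 1 choose k + 1) / (n + 1)\<close>, the left
  side is \<open>1 / (n + 1)\<close> times the binomial expansion for \<open>n + 1\<close> without
  its zeroth term.\<close>

lemma expectation_inverse_Suc_binomial_pmf:
  assumes p: "p \<in> {0..1}"
  shows "p * measure_pmf.expectation (binomial_pmf n p) (\<lambda>k. 1 / real (Suc k)) \<le> 1 / real (Suc n)"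
proof -
  have "p * measure_pmf.expectation (binomial_pmf n p) (\<lambda>k. 1 / real (Suc k)) =
      (\<Sum>k\<le>n. 1 / real (Suc n) * (real (Suc n choose Suc k) * p ^ Suc k * (1 - p) ^ (n - k)))"
  proof -
    have "p * (1 / real (Suc k) * (real (n choose k) * p ^ k * (1 - p) ^ (n - k))) =
       1 / real (Suc n) * (real (Suc n choose Suc k) * p ^ Suc k * (1 - p) ^ (n - k))" for k
    proof -
      have "real (Suc k) * real (Suc n choose Suc k) = real (Suc n) * real (n choose k)"
        using Suc_times_binomial_eq[of n k] by (simp only: flip: of_nat_mult) (simp add: mult.commute)
      then have "real (n choose k) / real (Suc k) = real (Suc n choose Suc k) / real (Suc n)"
        by (simp add: frac_eq_eq del: binomial_Suc_Suc of_nat_Suc) (simp add: mult.commute)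
      then have "real (n choose k) / real (Suc k) * (p ^ Suc k * (1 - p) ^ (n - k)) =
          real (Suc n choose Suc k) / real (Suc n) * (p ^ Suc k * (1 - p) ^ (n - k))"
        by (rule arg_cong)
      then show ?thesis
        by (simp add: mult_ac del: binomial_Suc_Suc of_nat_Suc)
    qed
    then show ?thesis
      unfolding expectation_binomial_pmf[OF p] sum_distrib_left by (intro sum.cong) auto
  qed
  also have "\<dots> = 1 / real (Suc n) * (\<Sum>k\<in>Suc ` {..n}. real (Suc n choose k) * p ^ k * (1 - p) ^ (Suc n - k))"
    by (simp add: sum_distrib_left sum.reindex del: binomial_Suc_Suc)
  also have "\<dots> \<le> 1 / real (Suc n) * (\<Sum>k\<le>Suc n. real (Suc n choose k) * p ^ k * (1 - p) ^ (Suc n - k))"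
    using p by (intro mult_left_mono sum_mono2) auto
  also have "(\<Sum>k\<le>Suc n. real (Suc n choose k) * p ^ k * (1 - p) ^ (Suc n - k)) = 1"
    using binomial_ring[of p "1 - p" "Suc n"] by simp
  finally show ?thesis by simp
qed

text \<open>A discrete integral of \<open>1 / sqrt x\<close>: the largest element \<open>b\<close>
  adds at most twice the increase of the square root. In \<open>mean_bias\<close> this bounds the
  total error of a dyadic class regardless of its size.\<close>

lemma sum_weight_div_sqrt_prefix_le:
  fixes p :: "'a :: linorder \<Rightarrow> real"
  assumes "finite C" "\<And>y. y \<in> C \<Longrightarrow> p y > 0"
  shows "(\<Sum>y\<in>C. p y / sqrt (\<Sum>z\<in>{z\<in>C. z \<le> y}. p z)) \<le> 2 * sqrt (\<Sum>y\<in>C. p y)"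
  using assms
proof (induction C rule: finite_linorder_max_induct)
  case (insert b C)
  let ?s = "\<Sum>y\<in>C. p y"
  have b: "p b > 0" and s: "?s \<ge> 0" using insert.prems by (auto intro!: sum_nonneg intro: less_imp_le)
  have nin: "b \<notin> C" using insert.hyps by auto
  have 1: "{z \<in> insert b C. z \<le> y} = {z\<in>C. z \<le> y}" if "y \<in> C" for y
    using that insert.hyps by auto
  have 2: "{z \<in> insert b C. z \<le> b} = insert b C"
    using insert.hyps by auto
  have "p b = (sqrt (?s + p b) - sqrt ?s) * (sqrt (?s + p b) + sqrt ?s)"
    using b s by (simp add: algebra_simps)
  also have "\<dots> \<le> (sqrt (?s + p b) - sqrt ?s) * (2 * sqrt (?s + p b))"
    using b by (intro mult_left_mono) auto
  finally have "p b / sqrt (?s + p b) \<le> 2 * (sqrt (?s + p b) - sqrt ?s)"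
    using b s by (simp add: field_simps)
  moreover have "(\<Sum>y\<in>C. p y / sqrt (\<Sum>z\<in>{z\<in>C. z \<le> y}. p z)) \<le> 2 * sqrt ?s"
    using insert.IH insert.prems by blast
  ultimately have "(\<Sum>y\<in>C. p y / sqrt (\<Sum>z\<in>{z\<in>C. z \<le> y}. p z)) + p b / sqrt (p b + ?s)
      \<le> 2 * sqrt (p b + ?s)"
    by (simp add: algebra_simps)
  then show ?case
    using insert.hyps nin by (simp add: 1 2 add.commute del: insert_iff)
qed simp

subsection \<open>The truncated ratio of two binomial estimates\<close>

text \<open>Bounding only the deficit makes small \<open>a\<close> harmless: for
  \<open>a \<le> A\<close>, replacing \<open>a\<close> by \<open>A\<close> increases the deficit;
  otherwise the common denominator \<open>a\<close> may be lowered to \<open>A\<close>. Here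
  \<open>y\<close> and \<open>a\<close> stand for estimates of \<open>w * A\<close> and
  \<open>A\<close>.\<close>

lemma ratio_deficit_le:
  fixes A a q y w :: real
  assumes "A > 0" "a > 0" "q \<ge> 0" "y \<ge> 0" "w \<ge> 0"
  shows "q * w - q * y / a \<le> q / A * \<bar>y - w * A\<bar> + q * w / A * \<bar>a - A\<bar>"
proof (cases "a \<le> A")
  case True
  have "q * y / A \<le> q * y / a"
    using assms True by (intro divide_left_mono) auto
  then have "q * w - q * y / a \<le> q / A * (w * A - y)"
    using assms by (simp add: field_simps)
  also have "\<dots> \<le> q / A * \<bar>y - w * A\<bar>"
    using assms by (intro mult_left_mono) auto
  finally show ?thesis
    using assms by (smt (verit) divide_nonneg_pos mult_nonneg_nonneg)
next
  case False
  have "q * w - q * y / a = (q * (w * A - y) + q * w * (a - A)) / a"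
    using assms by (simp add: field_simps)
  also have "\<dots> \<le> (q * \<bar>y - w * A\<bar> + q * w * \<bar>a - A\<bar>) / a"
    using assms by (intro divide_right_mono add_mono mult_left_mono) auto
  also have "\<dots> \<le> (q * \<bar>y - w * A\<bar> + q * w * \<bar>a - A\<bar>) / A"
    using assms False by (intro divide_left_mono) auto
  finally show ?thesis
    by (simp add: add_divide_distrib)
qed

text \<open>The \<open>+ 1\<close> in the denominator makes the untruncated ratio biased downwards only, so this upper
  bound is free of error terms and settles the elements with tiny ratio.\<close>

lemma truncated_ratio_mean_le:
  fixes A w q c :: real
  assumes A: "A \<in> {0..1}" and B: "w * A \<in> {0..1}" and "w \<ge> 0" "q \<ge> 0" "c \<ge> 0"
  shows "measure_pmf.expectation (binomial_pmf n A) (\<lambda>X.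
      measure_pmf.expectation (binomial_pmf n (w * A)) (\<lambda>Y. min (q * real Y / real (Suc X)) c))
    \<le> min (q * w) c" (is "?T \<le> _")
proof -
  let ?EA = "measure_pmf.expectation (binomial_pmf n A)"
  let ?EB = "measure_pmf.expectation (binomial_pmf n (w * A))"
  have "?T \<le> ?EA (\<lambda>X. ?EB (\<lambda>Y. c))"
    using A B by (intro integral_mono) auto
  then have "?T \<le> c" by simp
  have "?T \<le> ?EA (\<lambda>X. ?EB (\<lambda>Y. q / real (Suc X) * real Y))"
    using A B by (intro integral_mono) auto
  also have "\<dots> = ?EA (\<lambda>X. q * real n * w * A * (1 / real (Suc X)))"
    using B by (simp add: mean_binomial_pmf mult_ac)
  also have "\<dots> = q * real n * w * (A * ?EA (\<lambda>X. 1 / real (Suc X)))"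
    by (subst integral_mult_right_zero) (simp add: mult_ac)
  also have "\<dots> \<le> q * real n * w * (1 / real (Suc n))"
    using assms by (intro mult_left_mono expectation_inverse_Suc_binomial_pmf) auto
  also have "\<dots> = q * w * (real n / real (Suc n))"
    by simp
  also have "\<dots> \<le> q * w"
    using assms by (intro mult_left_le) auto
  finally show ?thesis
    using \<open>?T \<le> c\<close> by simp
qed

text \<open>The deviation of \<open>Y\<close>, the deviation of \<open>X\<close> and the
  \<open>+ 1\<close> in the denominator each cost at most \<open>1 / sqrt (real n * A)\<close> once
  \<open>real n * A \<ge> 1\<close>.\<close>

lemma truncated_ratio_mean_ge:
  fixes A w q c :: real
  assumes A: "A \<in> {0<..1}" and B: "w * A \<in> {0..1}" and w: "w \<ge> 0" and q: "q \<in> {0..1}"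
    and c: "c \<in> {0..1}" and "n > 0"
  shows "measure_pmf.expectation (binomial_pmf n A) (\<lambda>X.
      measure_pmf.expectation (binomial_pmf n (w * A)) (\<lambda>Y. min (q * real Y / real (Suc X)) c))
    \<ge> min (q * w) c - 3 / sqrt (real n * A)" (is "?T \<ge> _")
proof -
  let ?EA = "measure_pmf.expectation (binomial_pmf n A)"
  let ?EB = "measure_pmf.expectation (binomial_pmf n (w * A))"
  have A': "A \<in> {0..1}" and A0: "A > 0" using A by auto
  have T0: "?T \<ge> 0"
    using q c by (intro Bochner_Integration.integral_nonneg) auto
  have nA: "real n * A > 0" using A \<open>n > 0\<close> by auto
  show ?thesis
  proof (cases "real n * A \<ge> 1")
    case False
    \<comment> \<open>The error term is then at least 1, hence at least \<open>c\<close>, and the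
      bound is trivial.\<close>
    have "sqrt (real n * A) \<le> 1" using False by simp
    moreover have "sqrt (real n * A) > 0" using nA by simp
    ultimately have "3 / sqrt (real n * A) \<ge> 1"
      by (simp only: le_divide_eq_1_pos)
    then show ?thesis using T0 c by (auto simp: min_def)
  next
    case True
    \<comment> \<open>Rescaling by \<open>s\<close> reduces the truncated case \<open>q * w > c\<close> to \<open>q * w = c\<close>.\<close>
    obtain s where s: "0 \<le> s" "s \<le> 1" "s * (q * w) = min (q * w) c"
    proof (cases "q * w \<le> c")
      case True
      then show ?thesis by (intro that[of 1]) auto
    next
      case False
      then show ?thesis
        using c by (intro that[of "c / (q * w)"]) auto
    qed
    have sv: "0 \<le> s * (q * w)" "s * (q * w) \<le> 1"
      using s q w c by auto
    \<comment> \<open>The two terms of \<open>ratio_deficit_le\<close> scaled by \<open>s\<close>;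
      the \<open>1 / real n\<close> in \<open>g\<close> pays for the \<open>+ 1\<close> of
      \<open>Suc X\<close>.\<close>
    define f where "f = (\<lambda>Y::nat. s * q / A * \<bar>real Y / real n - w * A\<bar>)"
    define g where "g = (\<lambda>X::nat. s * (q * w) / A * (\<bar>real X / real n - A\<bar> + 1 / real n))"
    have pointwise: "min (q * w) c - (f Y + g X) \<le> min (q * real Y / real (Suc X)) c" for X Y
    proof -
      define u where "u = q * real Y / real (Suc X)"
      have u: "u \<ge> 0" "u = q * (real Y / real n) / (real (Suc X) / real n)"
        using q \<open>n > 0\<close> by (auto simp: u_def)
      have "q * w - u \<le> q / A * \<bar>real Y / real n - w * A\<bar> + q * w / A * \<bar>real (Suc X) / real n - A\<bar>"
        unfolding u(2) using A q w \<open>n > 0\<close> by (intro ratio_deficit_le) auto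
      also have "\<dots> \<le> q / A * \<bar>real Y / real n - w * A\<bar> + q * w / A * (\<bar>real X / real n - A\<bar> + 1 / real n)"
      proof -
        have "real (Suc X) / real n = real X / real n + 1 / real n"
          by (simp add: add_divide_distrib)
        then have "\<bar>real (Suc X) / real n - A\<bar> \<le> \<bar>real X / real n - A\<bar> + 1 / real n"
          using abs_triangle_ineq[of "real X / real n - A" "1 / real n"] by simp
        then show ?thesis
          using A q w by (intro add_left_mono mult_left_mono) auto
      qed
      finally have "s * (q * w - u) \<le> s * \<dots>"
        using s by (intro mult_left_mono) auto
      also have "\<dots> = f Y + g X"
        by (simp add: f_def g_def algebra_simps)
      finally have *: "min (q * w) c - s * u \<le> f Y + g X"
        using s by (simp add: algebra_simps)
      have "s * u \<le> u" using s u(1) by (intro mult_left_le_one_le)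
      moreover have "f Y + g X \<ge> 0"
        using s q w A sv by (auto simp: f_def g_def)
      ultimately show ?thesis
        using * unfolding u_def[symmetric] by (auto simp: min_def split: if_splits)
    qed
    have "?EA (\<lambda>X. ?EB (\<lambda>Y. min (q * w) c - (f Y + g X))) \<le> ?T"
      using A' B pointwise by (intro integral_mono) auto
    also have "?EA (\<lambda>X. ?EB (\<lambda>Y. min (q * w) c - (f Y + g X))) = min (q * w) c - (?EB f + ?EA g)"
      using A' B by simp
    finally have T: "?T \<ge> min (q * w) c - (?EB f + ?EA g)" .
    have r: "sqrt (real n * A) > 0" using nA by simp
    have "?EB f = s * q / A * ?EB (\<lambda>Y. \<bar>real Y / real n - w * A\<bar>)"
      by (simp add: f_def)
    also have "\<dots> \<le> s * q / A * sqrt (w * A / real n)"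
      using s q A B \<open>n > 0\<close> by (intro mult_left_mono mean_deviation_binomial_pmf) auto
    also have "\<dots> = sqrt ((s * q)\<^sup>2 / A\<^sup>2 * (w * A / real n))"
      using s q A by (simp add: real_sqrt_mult real_sqrt_divide)
    \<comment> \<open>Both factors of the numerator are at most 1, the second even when
      \<open>q * w\<close> far exceeds \<open>c\<close>.\<close>
    also have "(s * q)\<^sup>2 / A\<^sup>2 * (w * A / real n) = (s * q) * (s * (q * w)) / (real n * A)"
      using A by (simp add: field_simps power2_eq_square)
    also have "sqrt \<dots> \<le> sqrt (1 / (real n * A))"
    proof -
      have "s * q \<le> 1" using s q by (auto intro: mult_le_one)
      then have "(s * q) * (s * (q * w)) \<le> 1" using sv by (rule mult_le_one)
      then show ?thesis using nA by (intro real_sqrt_le_mono divide_right_mono) auto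
    qed
    finally have F: "?EB f \<le> 1 / sqrt (real n * A)"
      by (simp add: real_sqrt_divide)
    have "?EA g = s * (q * w) / A * (?EA (\<lambda>X. \<bar>real X / real n - A\<bar>) + 1 / real n)"
      using A' by (simp add: g_def)
    also have "\<dots> \<le> 1 / A * (sqrt (A / real n) + 1 / real n)"
      using sv A A' \<open>n > 0\<close>
      by (intro mult_mono divide_right_mono add_right_mono mean_deviation_binomial_pmf)
        (auto intro!: add_nonneg_nonneg)
    also have "\<dots> = 1 / sqrt (real n * A) + 1 / (real n * A)"
    proof -
      have "A = sqrt A * sqrt A" using A by simp
      then have "sqrt (A / real n) / A = 1 / sqrt (real n * A)"
        using A0 \<open>n > 0\<close>
        by (simp add: real_sqrt_divide real_sqrt_mult field_simps)
      then show ?thesis using A0 by (simp add: field_simps)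
    qed
    also have "1 / (real n * A) \<le> 1 / sqrt (real n * A)"
    proof -
      have "sqrt (real n * A) * 1 \<le> sqrt (real n * A) * sqrt (real n * A)"
        using True by (intro mult_left_mono) auto
      then have "sqrt (real n * A) \<le> real n * A" using nA by simp
      then show ?thesis using r nA by (intro divide_left_mono) auto
    qed
    finally have G: "?EA g \<le> 2 / sqrt (real n * A)" by simp
    from T F G show ?thesis by (simp add: field_simps)
  qed
qed

subsection \<open>Duels between an element and the cells of lighter elements\<close>

text \<open>
  Keys split \<open>{1..M}\<close> into \<open>num_keys Q y = O(1 / Q y)\<close> cells: \<open>{y}\<close> itself and, for each \<open>k\<close>, the
  elements whose initial segment has \<open>Q\<close>-mass in \<open>[k Q y, (k + 1) Q y)\<close>.  By monotonicity of \<open>Q\<close>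
  the elements below \<open>y\<close> in one cell have total \<open>Q\<close>-mass at most \<open>2 Q y\<close>.
\<close>

definition key :: "nat pmf \<Rightarrow> nat \<Rightarrow> nat \<Rightarrow> nat" where
  "key Q y z = (if z = y then nat \<lfloor>1 / pmf Q y\<rfloor> + 1
     else nat \<lfloor>measure_pmf.prob Q {..<z} / pmf Q y\<rfloor>)"

definition num_keys :: "nat pmf \<Rightarrow> nat \<Rightarrow> nat" where
  "num_keys Q y = nat \<lfloor>1 / pmf Q y\<rfloor> + 2"

definition cell :: "nat \<Rightarrow> nat pmf \<Rightarrow> nat \<Rightarrow> nat \<Rightarrow> nat set" where
  "cell M Q y k = {z \<in> {1..M}. key Q y z = k}"

text \<open>The cell of \<open>y\<close> is \<open>{y}\<close>, and querying it would tell nothing;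
  a fair coin satisfies the balance equation there, as both sides have mass
  \<open>P y\<close>.\<close>

definition duel :: "nat \<Rightarrow> nat pmf \<Rightarrow> nat \<Rightarrow> nat \<Rightarrow> bool cond_alg" where
  "duel M Q y k =
     (if k = key Q y y then Draw (map_pmf Return (bernoulli_pmf (1 / 2)))
      else Query (insert y (cell M Q y k)) (\<lambda>i. Return (i \<noteq> y)))"

text \<open>The success probabilities of \<open>challenge\<close> and \<open>defence\<close> are the
  \<open>A\<close> and \<open>B\<close> of the identity \<open>B = P(y) N A\<close>.\<close>

definition challenge :: "nat \<Rightarrow> nat pmf \<Rightarrow> nat \<Rightarrow> bool cond_alg" where
  "challenge M Q y = Draw (map_pmf (duel M Q y) (pmf_of_set {..<num_keys Q y}))"

definition defence :: "nat \<Rightarrow> nat pmf \<Rightarrow> nat \<Rightarrow> bool cond_alg" where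
  "defence M Q y = Query {1..M} (\<lambda>x. bind_alg (duel M Q y (key Q y x)) (\<lambda>b. Return (\<not> b)))"

lemma finite_cell: "finite (cell M Q y k)"
  by (simp add: cell_def)

lemma queries_within_duel:
  assumes "y \<in> {1..M}"
  shows "queries_within M 1 (duel M Q y k)"
proof -
  have "insert y (cell M Q y k) \<subseteq> {1..M}"
    using assms by (auto simp: cell_def)
  then have "queries_within M (Suc 0) (Query (insert y (cell M Q y k)) (\<lambda>i. Return (i \<noteq> y)))"
    by (intro queries_within.intros)
  then show ?thesis
    by (auto simp: duel_def intro!: queries_within.intros(1,2))
qed

lemma queries_within_challenge:
  "y \<in> {1..M} \<Longrightarrow> queries_within M 1 (challenge M Q y)"
  unfolding challenge_def by (rule queries_within.intros(2)) (auto intro!: queries_within_duel simp del: One_nat_def)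

lemma queries_within_defence:
  assumes "y \<in> {1..M}"
  shows "queries_within M 2 (defence M Q y)"
proof -
  have "queries_within M (1 + 0) (bind_alg (duel M Q y k) (\<lambda>b. Return (\<not> b)))" for k
    by (intro queries_within_bind_alg queries_within_duel assms queries_within.intros(1))
  then have "queries_within M (Suc 1) (defence M Q y)"
    unfolding defence_def by (intro queries_within.intros(3)) simp_all
  then show ?thesis by (simp add: numeral_2_eq_2)
qed

context
  fixes M :: nat and Q :: "nat pmf" and y :: nat
  assumes Qy: "pmf Q y > 0"
begin

lemma num_keys_bounds: "1 \<le> pmf Q y * num_keys Q y" "pmf Q y * num_keys Q y \<le> 3"
proof -
  have fl: "real (nat \<lfloor>1 / pmf Q y\<rfloor>) = of_int \<lfloor>1 / pmf Q y\<rfloor>"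
    using Qy by simp
  have "1 / pmf Q y \<le> num_keys Q y"
    unfolding num_keys_def of_nat_add fl by linarith
  then show "1 \<le> pmf Q y * num_keys Q y"
    using Qy by (simp add: field_simps)
  have "num_keys Q y \<le> 1 / pmf Q y + 2"
    unfolding num_keys_def of_nat_add fl by linarith
  then have "pmf Q y * num_keys Q y \<le> 1 + 2 * pmf Q y"
    using Qy by (simp add: field_simps)
  then show "pmf Q y * num_keys Q y \<le> 3"
    using pmf_le_1[of Q y] by linarith
qed

lemma key_less: "z \<noteq> y \<Longrightarrow> key Q y z < key Q y y"
proof -
  have "nat \<lfloor>measure_pmf.prob Q {..<z} / pmf Q y\<rfloor> \<le> nat \<lfloor>1 / pmf Q y\<rfloor>"
    using Qy by (intro nat_mono floor_mono divide_right_mono) auto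
  then show "z \<noteq> y \<Longrightarrow> key Q y z < key Q y y"
    by (simp add: key_def)
qed

lemma key_less_num_keys: "key Q y z < num_keys Q y"
  using key_less[of z] by (cases "z = y") (auto simp: key_def num_keys_def)

lemma cell_own: "y \<in> {1..M} \<Longrightarrow> cell M Q y (key Q y y) = {y}"
  using key_less by (force simp: cell_def)

lemma sum_over_cells: "(\<Sum>k<num_keys Q y. \<Sum>z\<in>cell M Q y k. f z) = (\<Sum>z\<in>{1..M}. f z :: real)"
  unfolding cell_def using key_less_num_keys by (intro sum.group) auto

text \<open>The initial segments below the minimum \<open>a\<close> and the maximum \<open>b\<close>
  of \<open>Z\<close> have masses in one window of width \<open>Q y\<close>. So
  \<open>{a..<b}\<close> has mass at most \<open>Q y\<close>, and \<open>b\<close>, being light,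
  adds at most as much again.\<close>

lemma light_cell_mass:
  assumes Z: "Z \<subseteq> cell M Q y k" and k: "k \<noteq> key Q y y"
    and light: "\<And>z. z \<in> Z \<Longrightarrow> pmf Q z \<le> pmf Q y"
  shows "measure_pmf.prob Q Z \<le> 2 * pmf Q y"
proof (cases "Z = {}")
  case False
  have fin: "finite Z" using Z finite_cell finite_subset by blast
  define a b where "a = Min Z" and "b = Max Z"
  have ab: "a \<in> Z" "b \<in> Z" "a \<le> b" using fin False by (auto simp: a_def b_def)
  have rank: "real k * pmf Q y \<le> measure_pmf.prob Q {..<z}"
       "measure_pmf.prob Q {..<z} \<le> (real k + 1) * pmf Q y" if "z \<in> Z" for z
  proof -
    have "key Q y z = k" "z \<noteq> y" using that Z k by (auto simp: cell_def)
    then have "k = nat \<lfloor>measure_pmf.prob Q {..<z} / pmf Q y\<rfloor>" by (simp add: key_def)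
    then have "real k = of_int \<lfloor>measure_pmf.prob Q {..<z} / pmf Q y\<rfloor>"
      using Qy by simp
    then have "real k \<le> measure_pmf.prob Q {..<z} / pmf Q y"
        "measure_pmf.prob Q {..<z} / pmf Q y \<le> real k + 1"
      by linarith+
    then show "real k * pmf Q y \<le> measure_pmf.prob Q {..<z}"
       "measure_pmf.prob Q {..<z} \<le> (real k + 1) * pmf Q y"
      using Qy by (simp_all add: field_simps)
  qed
  have "Z \<subseteq> insert b {a..<b}"
    proof
    fix z assume "z \<in> Z"
    then have "a \<le> z" "z \<le> b" using fin by (simp_all add: a_def b_def)
    then show "z \<in> insert b {a..<b}" by auto
  qed
  then have "measure_pmf.prob Q Z \<le> measure_pmf.prob Q (insert b {a..<b})"
    by (intro measure_pmf.finite_measure_mono) auto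
  also have "\<dots> = pmf Q b + measure_pmf.prob Q {a..<b}"
    by (simp add: measure_measure_pmf_finite)
  also have "measure_pmf.prob Q {a..<b} = measure_pmf.prob Q {..<b} - measure_pmf.prob Q {..<a}"
  proof -
    have "{..<b} = {..<a} \<union> {a..<b}" using ab by auto
    then show ?thesis
      by (simp add: measure_pmf.finite_measure_Union ivl_disj_int)
  qed
  also have "\<dots> \<le> pmf Q y"
    using rank(1)[of a] rank(2)[of b] ab by (simp add: algebra_simps)
  finally show ?thesis using light[of b] ab by simp
qed simp

end

section \<open>Winning probabilities under the oracle\<close>

context
  fixes M :: nat and P Q :: "nat pmf" and Orc :: "nat set \<Rightarrow> nat pmf" and y :: nat
  assumes supp: "set_pmf P \<subseteq> {1..M}" and orc: "is_cond_oracle M P Orc"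
    and y: "y \<in> {1..M}" and Qy: "pmf Q y > 0"
begin

abbreviation "win k \<equiv> pmf (run Orc (duel M Q y k)) True"

lemma win_own: "win (key Q y y) = 1 / 2"
  by (simp add: duel_def map_pmf_comp run_Draw_map bind_return_pmf' del: run.simps(2))

text \<open>This also holds when \<open>P\<close> vanishes on the queried set and the reply is arbitrary.\<close>

lemma duel_balance: "pmf P y * win k = measure_pmf.prob P (cell M Q y k) * (1 - win k)"
proof (cases "k = key Q y y")
  case True
  then show ?thesis using win_own by (simp add: cell_own[OF Qy y] measure_pmf_single)
next
  case False
  define S where "S = insert y (cell M Q y k)"
  have S: "S \<subseteq> {1..M}" "y \<in> S" using y by (auto simp: S_def cell_def)
  have "y \<notin> cell M Q y k" using False by (auto simp: cell_def)
  then have PS: "measure_pmf.prob P S = pmf P y + measure_pmf.prob P (cell M Q y k)"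
    by (simp add: S_def measure_measure_pmf_finite finite_cell)
  have "run Orc (duel M Q y k) = map_pmf (\<lambda>i. i \<noteq> y) (Orc S)"
    using False by (simp add: duel_def S_def map_pmf_def)
  then have "win k = measure_pmf.prob (Orc S) {i. i \<noteq> y}"
    by (simp add: pmf_map vimage_def)
  also have "{i. i \<noteq> y} = - {y}" by auto
  also have "measure_pmf.prob (Orc S) (- {y}) = 1 - pmf (Orc S) y"
    using measure_pmf.prob_compl[of "{y}" "Orc S"] by (simp add: Compl_eq_Diff_UNIV measure_pmf_single)
  finally have win: "win k = 1 - pmf (Orc S) y" .
  show ?thesis
  proof (cases "measure_pmf.prob P S > 0")
    case True
    then have "pmf (Orc S) y = pmf P y / measure_pmf.prob P S"
      using orc S unfolding is_cond_oracle_def by blast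
    with win True PS show ?thesis by (simp add: field_simps)
  next
    case False
    then have "measure_pmf.prob P S = 0"
      using measure_nonneg[of "measure_pmf P" S] by linarith
    then have "pmf P y = 0 \<and> measure_pmf.prob P (cell M Q y k) = 0"
      unfolding PS by (simp add: add_nonneg_eq_0_iff)
    then show ?thesis by simp
  qed
qed

text \<open>The oracle is specified only at replies inside the queried set, but these probabilities
  already sum to 1. A query to the whole domain thus samples \<open>P\<close>.\<close>

lemma Orc_all: "Orc {1..M} = P"
proof -
  have 1: "measure_pmf.prob P {1..M} = 1"
    using sum_pmf_eq_1[OF finite_atLeastAtMost supp] by (simp only: measure_measure_pmf_finite finite_atLeastAtMost)
  have in_range: "pmf (Orc {1..M}) i = pmf P i" if "i \<in> {1..M}" for i
  proof -
    have "0 < measure_pmf.prob P {1..M}" unfolding 1 by simp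
    then have "pmf (Orc {1..M}) i = pmf P i / measure_pmf.prob P {1..M}"
      using orc that unfolding is_cond_oracle_def by blast
    then show ?thesis unfolding 1 by simp
  qed
  then have "(\<Sum>i\<in>{1..M}. pmf (Orc {1..M}) i) = (\<Sum>i\<in>{1..M}. pmf P i)"
    by (intro sum.cong) auto
  then have "measure_pmf.prob (Orc {1..M}) {1..M} = 1"
    using 1 by (simp only: measure_measure_pmf_finite finite_atLeastAtMost)
  then have "AE i in measure_pmf (Orc {1..M}). i \<in> {1..M}"
    by (rule measure_pmf.AE_prob_1)
  then have suppO: "set_pmf (Orc {1..M}) \<subseteq> {1..M}"
    unfolding AE_measure_pmf_iff by blast
  show ?thesis
  proof (rule pmf_eqI)
    fix i
    show "pmf (Orc {1..M}) i = pmf P i"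
    proof (cases "i \<in> {1..M}")
      case False
      then have "i \<notin> set_pmf (Orc {1..M})" "i \<notin> set_pmf P" using supp suppO by blast+
      then show ?thesis unfolding set_pmf_iff by simp
    qed (rule in_range)
  qed
qed

lemma challenge_prob:
  "pmf (run Orc (challenge M Q y)) True = (\<Sum>k<num_keys Q y. win k) / num_keys Q y"
proof -
  have "{..<num_keys Q y} \<noteq> {}" by (auto simp: num_keys_def)
  then show ?thesis
    unfolding challenge_def run_Draw_map pmf_bind by (subst integral_pmf_of_set) auto
qed

text \<open>Group the sample of \<open>P\<close> by its cell and apply \<open>duel_balance\<close>
  to each cell.\<close>

lemma defence_prob:
  "pmf (run Orc (defence M Q y)) True =
     pmf P y * num_keys Q y * pmf (run Orc (challenge M Q y)) True"
proof -
  have not: "pmf (run Orc (bind_alg (duel M Q y k) (\<lambda>b. Return (\<not> b)))) True = 1 - win k" for k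
  proof -
    have "run Orc (bind_alg (duel M Q y k) (\<lambda>b. Return (\<not> b))) = map_pmf Not (bernoulli_pmf (win k))"
      by (simp add: run_bind_alg map_pmf_def flip: bool_pmf_eq_bernoulli)
    moreover have "Not -` {True} = {False}" by auto
    ultimately show ?thesis
      by (simp add: pmf_map pmf_le_1 measure_pmf_single)
  qed
  have "pmf (run Orc (defence M Q y)) True = (\<Sum>x\<in>{1..M}. (1 - win (key Q y x)) * pmf P x)"
    unfolding defence_def run.simps pmf_bind Orc_all
    by (subst integral_measure_pmf_real[of "{1..M}"]) (use supp not in auto)
  also have "\<dots> = (\<Sum>k<num_keys Q y. \<Sum>x\<in>cell M Q y k. (1 - win (key Q y x)) * pmf P x)"
    by (rule sum_over_cells[OF Qy, symmetric])
  also have "\<dots> = (\<Sum>k<num_keys Q y. measure_pmf.prob P (cell M Q y k) * (1 - win k))"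
    unfolding measure_measure_pmf_finite[OF finite_cell] sum_distrib_right
    by (intro sum.cong refl) (simp add: cell_def)
  also have "\<dots> = pmf P y * (\<Sum>k<num_keys Q y. win k)"
    by (simp flip: duel_balance add: sum_distrib_left)
  finally show ?thesis
    using num_keys_bounds(1)[OF Qy] by (auto simp: challenge_prob)
qed

text \<open>A cell containing \<open>Q\<close>-mass \<open>?t k\<close> of \<open>Z\<close> wins
  with probability at least \<open>?t k / (4 * pmf Q y)\<close>. Averaging over at most
  \<open>3 / Q y\<close> cells gives \<open>12 = 4 * 3\<close>.\<close>

lemma challenge_prob_ge:
  assumes Z: "Z \<subseteq> {1..M}" and Py: "pmf P y > 0"
    and light: "\<And>z. z \<in> Z \<Longrightarrow> pmf Q z \<le> pmf Q y"
    and ratio: "\<And>z. z \<in> Z \<Longrightarrow> pmf P y * pmf Q z \<le> 2 * pmf P z * pmf Q y"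
  shows "(\<Sum>z\<in>Z. pmf Q z) / 12 \<le> pmf (run Orc (challenge M Q y)) True"
proof -
  let ?t = "\<lambda>k. measure_pmf.prob Q (Z \<inter> cell M Q y k)"
  have win_ge: "?t k / (4 * pmf Q y) \<le> win k" for k
  proof (cases "k = key Q y y")
    case True
    have "?t k \<le> measure_pmf.prob Q {y}"
      unfolding True cell_own[OF Qy y] by (intro measure_pmf.finite_measure_mono) auto
    then show ?thesis
      unfolding True win_own using Qy by (simp add: field_simps measure_pmf_single)
  next
    case False
    \<comment> \<open>By \<open>ratio\<close>, the cell has at least \<open>\<tau>\<close> times the
      \<open>P\<close>-mass of \<open>y\<close>; \<open>light_cell_mass\<close> keeps
      \<open>\<tau>\<close> at most 1.\<close>
    define \<tau> where "\<tau> = ?t k / (2 * pmf Q y)"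
    have "?t k \<le> 2 * pmf Q y"
      using False light by (intro light_cell_mass[OF Qy, where k = k]) auto
    then have \<tau>: "0 \<le> \<tau>" "\<tau> \<le> 1"
      using Qy by (simp_all add: \<tau>_def)
    have "?t k * pmf P y = (\<Sum>z\<in>Z \<inter> cell M Q y k. pmf P y * pmf Q z)"
      by (simp add: measure_measure_pmf_finite finite_cell sum_distrib_left mult.commute)
    also have "\<dots> \<le> (\<Sum>z\<in>Z \<inter> cell M Q y k. 2 * pmf P z * pmf Q y)"
      using ratio by (intro sum_mono) auto
    also have "\<dots> = 2 * pmf Q y * measure_pmf.prob P (Z \<inter> cell M Q y k)"
      by (simp add: measure_measure_pmf_finite finite_cell sum_distrib_left mult_ac)
    also have "\<dots> \<le> 2 * pmf Q y * measure_pmf.prob P (cell M Q y k)"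
      using Qy by (intro mult_left_mono measure_pmf.finite_measure_mono) auto
    finally have cell_ge: "\<tau> * pmf P y \<le> measure_pmf.prob P (cell M Q y k)"
      using Qy by (simp add: \<tau>_def field_simps)
    have "\<tau> / 2 \<le> win k"
    \<comment> \<open>A cell winning less often than \<open>\<tau> / 2 \<le> 1 / 2\<close> loses at
      least half of the time, against \<open>duel_balance\<close>.\<close>
    proof (rule ccontr)
      assume "\<not> \<tau> / 2 \<le> win k"
      then have w: "win k < \<tau> / 2" "1 / 2 \<le> 1 - win k" using \<tau> by auto
      have "\<tau> * pmf P y * (1 / 2) \<le> measure_pmf.prob P (cell M Q y k) * (1 - win k)"
        using cell_ge w \<tau> Py by (intro mult_mono) auto
      also have "\<dots> = pmf P y * win k" by (simp add: duel_balance)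
      also have "\<dots> < pmf P y * (\<tau> / 2)" using w Py by (intro mult_strict_left_mono)
      finally show False by simp
    qed
    then show ?thesis by (simp add: \<tau>_def)
  qed
  have "(\<Sum>z\<in>Z. pmf Q z) = (\<Sum>z\<in>{1..M}. if z \<in> Z then pmf Q z else 0)"
    using Z by (simp add: sum.If_cases Int_absorb1)
  also have "\<dots> = (\<Sum>k<num_keys Q y. \<Sum>z\<in>cell M Q y k. if z \<in> Z then pmf Q z else 0)"
    by (rule sum_over_cells[OF Qy, symmetric])
  also have "\<dots> = (\<Sum>k<num_keys Q y. ?t k)"
    by (intro sum.cong refl)
      (simp add: measure_measure_pmf_finite finite_cell sum.If_cases Int_commute)
  also have "\<dots> = 4 * pmf Q y * (\<Sum>k<num_keys Q y. ?t k / (4 * pmf Q y))"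
    using Qy by (simp flip: sum_divide_distrib)
  also have "\<dots> \<le> 4 * pmf Q y * (\<Sum>k<num_keys Q y. win k)"
    using Qy win_ge by (intro mult_left_mono sum_mono) auto
  also have "\<dots> = 4 * (pmf Q y * num_keys Q y) * pmf (run Orc (challenge M Q y)) True"
    using num_keys_bounds(1)[OF Qy] by (simp add: challenge_prob)
  also have "\<dots> \<le> 4 * 3 * pmf (run Orc (challenge M Q y)) True"
    using num_keys_bounds[OF Qy] by (intro mult_right_mono mult_left_mono) auto
  finally show ?thesis by simp
qed

end

subsection \<open>The bias of a single trial\<close>

text \<open>\<open>Y / X\<close> estimates \<open>B / A = P(y) N\<close>, so the coin's bias
  estimates the truncated ratio. Flipping the coin keeps the mean and makes the final count
  binomial.\<close>

definition trial :: "nat \<Rightarrow> nat \<Rightarrow> nat pmf \<Rightarrow> real \<Rightarrow> real \<Rightarrow> nat \<Rightarrow> bool cond_alg" where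
  "trial n M Q c1 c2 y =
     bind_alg (tally n (challenge M Q y)) (\<lambda>X. bind_alg (tally n (defence M Q y)) (\<lambda>Y.
       Draw (map_pmf Return (bernoulli_pmf
         (min (c1 / (pmf Q y * num_keys Q y) * real Y / real (Suc X)) c2)))))"

definition estimator ::
  "nat \<Rightarrow> nat \<Rightarrow> nat \<Rightarrow> nat pmf \<Rightarrow> real \<Rightarrow> real \<Rightarrow> (nat set \<times> real) cond_alg" where
  "estimator m n M Q c1 c2 =
     bind_alg (tally m (Draw (map_pmf (trial n M Q c1 c2) Q))) (\<lambda>Z. Return ({1..M}, real Z / real m))"

lemma queries_within_estimator:
  assumes "set_pmf Q \<subseteq> {1..M}"
  shows "queries_within M (m * (3 * n)) (estimator m n M Q c1 c2)"
proof -
  have "queries_within M (n * 1 + (n * 2 + 0)) (trial n M Q c1 c2 y)" if "y \<in> {1..M}" for y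
    unfolding trial_def
    by (intro queries_within_bind_alg queries_within_tally queries_within_challenge
          queries_within_defence that queries_within.intros(2))
      (auto intro: queries_within.intros)
  then have trial: "queries_within M (3 * n) (trial n M Q c1 c2 y)" if "y \<in> {1..M}" for y
    using that by (simp add: algebra_simps)
  have "queries_within M (m * (3 * n) + 0) (estimator m n M Q c1 c2)"
    unfolding estimator_def
    by (intro queries_within_bind_alg queries_within_tally queries_within.intros(1,2))
      (use assms trial in auto)
  then show ?thesis by simp
qed

context
  fixes M :: nat and P Q :: "nat pmf" and Orc :: "nat set \<Rightarrow> nat pmf" and c1 c2 :: real and n :: nat
  assumes supp: "set_pmf P \<subseteq> {1..M}" and orc: "is_cond_oracle M P Orc"
    and c1: "c1 \<in> {0..1}" and c2: "c2 \<in> {0..1}" and n: "n > 0"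
begin

abbreviation "trial_mean y \<equiv> pmf (run Orc (trial n M Q c1 c2 y)) True"

lemma trial_mean_eq:
  assumes y: "y \<in> {1..M}" and Qy: "pmf Q y > 0"
  defines "A \<equiv> pmf (run Orc (challenge M Q y)) True"
  shows "trial_mean y = measure_pmf.expectation (binomial_pmf n A) (\<lambda>X.
    measure_pmf.expectation (binomial_pmf n (pmf P y * num_keys Q y * A))
      (\<lambda>Y. min (c1 / (pmf Q y * num_keys Q y) * real Y / real (Suc X)) c2))"
  using c1 c2 Qy
  by (auto simp: trial_def A_def run_bind_alg run_tally pmf_bind map_pmf_comp run_Draw_map
      bind_return_pmf' defence_prob[OF supp orc y Qy] simp del: run.simps(2) of_nat_Suc
      intro!: Bochner_Integration.integral_cong pmf_bernoulli_True)

lemma trial_mean_le: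
  assumes y: "y \<in> {1..M}" and Qy: "pmf Q y > 0"
  shows "trial_mean y \<le> min (c1 * pmf P y / pmf Q y) c2"
proof -
  note N = num_keys_bounds(1)[OF Qy]
  have "c1 * pmf P y / pmf Q y = c1 / (pmf Q y * num_keys Q y) * (pmf P y * num_keys Q y)"
    using N by auto
  then show ?thesis
    unfolding trial_mean_eq[OF assms] using c1 c2 Qy
    by (simp only:, intro truncated_ratio_mean_le)
      (auto simp flip: defence_prob[OF supp orc y Qy] simp: pmf_le_1)
qed

lemma trial_mean_ge:
  assumes y: "y \<in> {1..M}" and Qy: "pmf Q y > 0" and Py: "pmf P y > 0"
    and Z: "Z \<subseteq> {1..M}" and mass: "(\<Sum>z\<in>Z. pmf Q z) > 0"
    and light: "\<And>z. z \<in> Z \<Longrightarrow> pmf Q z \<le> pmf Q y"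
    and ratio: "\<And>z. z \<in> Z \<Longrightarrow> pmf P y * pmf Q z \<le> 2 * pmf P z * pmf Q y"
  shows "min (c1 * pmf P y / pmf Q y) c2 - trial_mean y \<le> 11 / sqrt (real n) / sqrt (\<Sum>z\<in>Z. pmf Q z)"
proof -
  note N = num_keys_bounds(1)[OF Qy]
  define A where "A = pmf (run Orc (challenge M Q y)) True"
  let ?s = "\<Sum>z\<in>Z. pmf Q z"
  have A: "?s / 12 \<le> A"
    unfolding A_def by (rule challenge_prob_ge[OF supp orc y Qy Z Py light ratio])
  then have A01: "A \<in> {0<..1}" using mass by (auto simp: A_def pmf_le_1)
  have q: "c1 / (pmf Q y * num_keys Q y) \<in> {0..1}"
    using c1 N by (auto simp: divide_le_eq_1)
  have "c1 * pmf P y / pmf Q y = c1 / (pmf Q y * num_keys Q y) * (pmf P y * num_keys Q y)"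
    using N by auto
  moreover have "pmf P y * num_keys Q y * A \<in> {0..1}"
    by (simp flip: defence_prob[OF supp orc y Qy] add: A_def pmf_le_1)
  ultimately have "trial_mean y \<ge> min (c1 * pmf P y / pmf Q y) c2 - 3 / sqrt (real n * A)"
    unfolding trial_mean_eq[OF y Qy, folded A_def] using c2 A01 n q
    by (simp only:, intro truncated_ratio_mean_ge) auto
  moreover have "3 / sqrt (real n * A) \<le> 11 / sqrt (real n) / sqrt ?s"
  proof -
    \<comment> \<open>As \<open>9 * 12 = 108 \<le> 121\<close>, the constant 11 absorbs
      \<open>3 * sqrt 12\<close>.\<close>
    have "3 * sqrt ?s = sqrt (9 * ?s)" by (simp add: real_sqrt_mult)
    also have "\<dots> \<le> sqrt (121 * A)" using A mass by simp
    also have "\<dots> = 11 * sqrt A" by (simp add: real_sqrt_mult)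
    finally have "3 / sqrt A \<le> 11 / sqrt ?s"
      using A01 mass by (simp add: field_simps)
    then have "3 / sqrt A / sqrt (real n) \<le> 11 / sqrt ?s / sqrt (real n)"
      using n by (intro divide_right_mono) auto
    then show ?thesis by (simp add: real_sqrt_mult mult.commute)
  qed
  ultimately show ?thesis by linarith
qed

text \<open>The deficits \<open>d y\<close> are nonnegative by \<open>trial_mean_le\<close>, so the
  bias is exactly their sum and can be bounded element by element.\<close>

lemma mean_bias:
  assumes suppQ: "set_pmf Q \<subseteq> {1..M}" and mono: "mono_on {1..M} (pmf Q)"
    and \<epsilon>: "\<epsilon> > 0" "1 / \<epsilon> \<le> 2 ^ L"
  shows "\<bar>pmf (run Orc (Draw (map_pmf (trial n M Q c1 c2) Q))) True -
      (\<Sum>y\<in>{1..M}. min (c1 * pmf P y) (c2 * pmf Q y))\<bar>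
    \<le> 2 * \<epsilon> + real (2 * L + 1) * (22 / sqrt (real n))"
proof -
  define d where "d y = min (c1 * pmf P y) (c2 * pmf Q y) - pmf Q y * trial_mean y" for y
  \<comment> \<open>Dyadic classes of the ratio \<open>P / Q\<close>: within a class, every lighter element has at least half
    the ratio of \<open>y\<close>, which makes the cells below \<open>y\<close> win often.\<close>
  define \<kappa> where "\<kappa> y = \<lfloor>log 2 (pmf P y / pmf Q y)\<rfloor>" for y
  define C where "C j = {z \<in> {1..M}. pmf Q z > 0 \<and> pmf P z > 0 \<and> \<kappa> z = j}" for j
  \<comment> \<open>The error of \<open>trial_mean_ge\<close> weighted by \<open>Q y\<close>, with
    \<open>Z\<close> the part of the class up to \<open>y\<close>; it is 0 outside the class, so
    that all classes can be summed.\<close>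
  define h where "h j y = (if y \<in> C j then
      11 / sqrt (real n) * (pmf Q y / sqrt (\<Sum>z\<in>{z\<in>C j. z \<le> y}. pmf Q z)) else 0)" for j y
  let ?J = "{- int L..int L}"
  have fin: "finite (C j)" for j by (simp add: C_def)
  have h_nonneg: "h j y \<ge> 0" for j y
    unfolding h_def by (auto intro!: mult_nonneg_nonneg divide_nonneg_nonneg sum_nonneg)
  have d_eq: "d y = pmf Q y * (min (c1 * pmf P y / pmf Q y) c2 - trial_mean y)" if "pmf Q y > 0" for y
    using that by (simp add: d_def min_mult_distrib_left algebra_simps)
  have d_nonneg: "d y \<ge> 0" if "y \<in> {1..M}" for y
  proof (cases "pmf Q y > 0")
    case True
    then show ?thesis
      using trial_mean_le[OF that True] unfolding d_eq[OF True] by simp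
  next
    case False
    then have "pmf Q y = 0" using pmf_nonneg[of Q y] by linarith
    then show ?thesis using c1 by (simp add: d_def)
  qed
  have d_le: "d y \<le> min (pmf P y) (pmf Q y)" for y
  proof -
    have "c1 * pmf P y \<le> pmf P y" "c2 * pmf Q y \<le> pmf Q y"
      using c1 c2 by (auto intro: mult_left_le_one_le)
    moreover have "pmf Q y * trial_mean y \<ge> 0" by simp
    ultimately show ?thesis unfolding d_def by linarith
  qed
  have pointwise: "d y \<le> \<epsilon> * pmf Q y + \<epsilon> * pmf P y + (\<Sum>j\<in>?J. h j y)" if y: "y \<in> {1..M}" for y
  proof -
    have h0: "(\<Sum>j\<in>?J. h j y) \<ge> 0" by (intro sum_nonneg h_nonneg)
    have nn: "\<epsilon> * pmf Q y \<ge> 0" "\<epsilon> * pmf P y \<ge> 0" using \<epsilon> by auto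
    \<comment> \<open>The first two cases are the extreme ratios, including zero masses; there
      \<open>d_le\<close> suffices.\<close>
    consider "pmf P y \<le> \<epsilon> * pmf Q y" | "pmf Q y \<le> \<epsilon> * pmf P y"
      | "\<epsilon> * pmf Q y < pmf P y" "\<epsilon> * pmf P y < pmf Q y" by linarith
    then show ?thesis
    proof cases
      case 3
      have Qy: "pmf Q y > 0" and Py: "pmf P y > 0" using 3 nn by linarith+
      have r: "pmf P y / pmf Q y > 0" using Py Qy by simp
      have "\<kappa> y \<in> ?J"
      proof -
        have "\<epsilon> < pmf P y / pmf Q y" using 3 Qy by (simp add: field_simps)
        moreover have "2 powr (- real L) \<le> \<epsilon>"
          using \<epsilon> by (simp add: powr_minus powr_realpow field_simps)
        ultimately have "- real L \<le> log 2 (pmf P y / pmf Q y)"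
          using r by (subst le_log_iff) auto
        moreover have "pmf P y / pmf Q y < 1 / \<epsilon>" using 3 Qy \<epsilon> by (simp add: field_simps)
        then have "pmf P y / pmf Q y \<le> 2 powr real L" using \<epsilon> by (simp add: powr_realpow)
        then have "log 2 (pmf P y / pmf Q y) \<le> real L"
          using r by (subst log_le_iff) auto
        ultimately show ?thesis unfolding \<kappa>_def by (auto simp: le_floor_iff floor_le_iff)
      qed
      let ?Z = "{z \<in> C (\<kappa> y). z \<le> y}"
      have yC: "y \<in> C (\<kappa> y)" using y Qy Py by (simp add: C_def)
      have mass: "(\<Sum>z\<in>?Z. pmf Q z) > 0"
        using yC Qy fin by (intro sum_pos2[of _ y]) auto
      have ratio: "pmf P y * pmf Q z \<le> 2 * pmf P z * pmf Q y" if "z \<in> ?Z" for z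
      proof -
        have z: "pmf Q z > 0" "pmf P z > 0" "\<kappa> z = \<kappa> y" using that by (auto simp: C_def)
        \<comment> \<open>Equal floors put the logarithms within 1 of each other, hence the ratios
          within a factor 2.\<close>
        then have "log 2 (pmf P y / pmf Q y) \<le> 1 + log 2 (pmf P z / pmf Q z)"
          unfolding \<kappa>_def by linarith
        also have "\<dots> = log 2 (2 * (pmf P z / pmf Q z))"
          using z by (subst log_mult) auto
        finally have "pmf P y / pmf Q y \<le> 2 * (pmf P z / pmf Q z)"
          using r z by (subst (asm) log_le_cancel_iff) auto
        then show ?thesis using z Qy by (simp add: field_simps)
      qed
      have "min (c1 * pmf P y / pmf Q y) c2 - trial_mean y
          \<le> 11 / sqrt (real n) / sqrt (\<Sum>z\<in>?Z. pmf Q z)"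
        by (intro trial_mean_ge y Qy Py mass ratio)
          (use mono y in \<open>auto simp: C_def mono_on_def\<close>)
      then have "d y \<le> pmf Q y * (11 / sqrt (real n) / sqrt (\<Sum>z\<in>?Z. pmf Q z))"
        unfolding d_eq[OF Qy] by (intro mult_left_mono) auto
      also have "\<dots> = h (\<kappa> y) y" using yC by (simp add: h_def)
      also have "\<dots> \<le> (\<Sum>j\<in>?J. h j y)"
        using \<open>\<kappa> y \<in> ?J\<close> h_nonneg by (intro member_le_sum) auto
      finally show ?thesis using nn by linarith
    qed (use d_le[of y] h0 nn in linarith)+
  qed
  have h_sum: "(\<Sum>y\<in>{1..M}. h j y) \<le> 22 / sqrt (real n)" for j
  proof -
    have "(\<Sum>y\<in>{1..M}. h j y) =
        11 / sqrt (real n) * (\<Sum>y\<in>C j. pmf Q y / sqrt (\<Sum>z\<in>{z\<in>C j. z \<le> y}. pmf Q z))"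
      unfolding sum_distrib_left
      by (rule sum.mono_neutral_cong_right) (auto simp: h_def C_def)
    also have "\<dots> \<le> 11 / sqrt (real n) * (2 * sqrt (\<Sum>y\<in>C j. pmf Q y))"
      using fin by (intro mult_left_mono sum_weight_div_sqrt_prefix_le) (auto simp: C_def)
    also have "\<dots> \<le> 11 / sqrt (real n) * (2 * 1)"
      using fin by (intro mult_left_mono) (auto simp flip: measure_measure_pmf_finite)
    finally show ?thesis by simp
  qed
  have total: "(\<Sum>y\<in>{1..M}. pmf R y) \<le> 1" for R :: "nat pmf"
    by (simp flip: measure_measure_pmf_finite)
  have "(\<Sum>y\<in>{1..M}. d y) \<le> (\<Sum>y\<in>{1..M}. \<epsilon> * pmf Q y + \<epsilon> * pmf P y + (\<Sum>j\<in>?J. h j y))"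
    by (intro sum_mono pointwise)
  also have "\<dots> = \<epsilon> * (\<Sum>y\<in>{1..M}. pmf Q y) + \<epsilon> * (\<Sum>y\<in>{1..M}. pmf P y) +
      (\<Sum>j\<in>?J. \<Sum>y\<in>{1..M}. h j y)"
    unfolding sum.distrib sum_distrib_left by (subst sum.swap[of _ ?J]) simp
  also have "\<dots> \<le> \<epsilon> * 1 + \<epsilon> * 1 + (\<Sum>j\<in>?J. 22 / sqrt (real n))"
    using \<epsilon> by (intro add_mono mult_left_mono total sum_mono h_sum) auto
  also have "\<dots> = 2 * \<epsilon> + real (2 * L + 1) * (22 / sqrt (real n))"
    by (simp add: nat_add_distrib)
  finally have upper: "(\<Sum>y\<in>{1..M}. d y) \<le> \<dots>" .
  have "pmf (run Orc (Draw (map_pmf (trial n M Q c1 c2) Q))) True =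
      (\<Sum>y\<in>{1..M}. trial_mean y * pmf Q y)"
    unfolding run_Draw_map pmf_bind
    by (rule integral_measure_pmf_real) (use suppQ in auto)
  then have "(\<Sum>y\<in>{1..M}. min (c1 * pmf P y) (c2 * pmf Q y)) -
      pmf (run Orc (Draw (map_pmf (trial n M Q c1 c2) Q))) True = (\<Sum>y\<in>{1..M}. d y)"
    by (simp add: d_def sum_subtractf mult.commute)
  moreover have "(\<Sum>y\<in>{1..M}. d y) \<ge> 0" by (intro sum_nonneg d_nonneg)
  ultimately show ?thesis using upper by linarith
qed

end

subsection \<open>Accuracy of the estimators\<close>

text \<open>\<open>n\<close> controls the bias, at most \<open>156 = 2 + 7 * 22\<close> times
  \<open>\<epsilon> * l\<close>; \<open>m\<close> controls the fluctuation of the final count, at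
  most \<open>\<epsilon>\<close> by Hoeffding's inequality outside an event of probability at most
  \<open>\<epsilon>\<close>.\<close>

lemma estimator_accurate:
  assumes \<epsilon>: "0 < \<epsilon>" "\<epsilon> \<le> 1 / 4"
    and suppQ: "set_pmf Q \<subseteq> {1..M}" and mono: "mono_on {1..M} (pmf Q)"
    and supp: "set_pmf P \<subseteq> {1..M}" and orc: "is_cond_oracle M P Orc"
    and c: "c1 \<in> {0..1}" "c2 \<in> {0..1}"
    and n: "1 / \<epsilon>\<^sup>2 \<le> real n" and m: "ln (1 / \<epsilon>) / \<epsilon>\<^sup>2 \<le> real m"
  shows "measure_pmf.prob (run Orc (estimator m n M Q c1 c2))
      {(S, v). S = {1..M} \<and>
        \<bar>v - (\<Sum>i\<in>{1..M}. min (c1 * pmf P i) (c2 * pmf Q i))\<bar> \<le> 200 * \<epsilon> * ln (1 / \<epsilon>)}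
    \<ge> 1 - \<epsilon>"
proof -
  define l where "l = ln (1 / \<epsilon>)"
  define \<mu> where "\<mu> = pmf (run Orc (Draw (map_pmf (trial n M Q c1 c2) Q))) True"
  define T where "T = (\<Sum>i\<in>{1..M}. min (c1 * pmf P i) (c2 * pmf Q i))"
  have l: "1 \<le> l"
  proof -
    have "exp 1 \<le> (4 :: real)" using exp_le by linarith
    also have "4 \<le> 1 / \<epsilon>" using \<epsilon> by (simp add: field_simps)
    finally show ?thesis using \<epsilon> by (simp add: l_def ln_ge_iff)
  qed
  have "1 / \<epsilon>\<^sup>2 > 0" "l / \<epsilon>\<^sup>2 > 0" using \<epsilon> l by auto
  then have nm: "n > 0" "m > 0" using n m unfolding l_def by (auto intro: gr0I)
  define L where "L = nat \<lceil>log 2 (1 / \<epsilon>)\<rceil>"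
  have log: "0 \<le> log 2 (1 / \<epsilon>)" "log 2 (1 / \<epsilon>) \<le> 2 * l"
  proof -
    show "0 \<le> log 2 (1 / \<epsilon>)" using \<epsilon> by simp
    have "1 / 2 \<le> ln (2 :: real)" using ln2_ge_two_thirds by simp
    then have "1 * l \<le> (2 * ln 2) * l" using l by (intro mult_right_mono) auto
    then show "log 2 (1 / \<epsilon>) \<le> 2 * l"
      by (simp add: log_def l_def[symmetric] field_simps)
  qed
  have L: "1 / \<epsilon> \<le> 2 ^ L" "real (2 * L + 1) \<le> 7 * l"
  proof -
    have "log 2 (1 / \<epsilon>) \<le> real L" unfolding L_def by linarith
    then have "1 / \<epsilon> \<le> 2 powr real L" using \<epsilon> by (subst (asm) log_le_iff) auto
    then show "1 / \<epsilon> \<le> 2 ^ L" by (simp add: powr_realpow)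
    have "real L \<le> log 2 (1 / \<epsilon>) + 1" unfolding L_def using log(1) by linarith
    \<comment> \<open>\<open>2 * L + 1 \<le> 4 * l + 3 \<le> 7 * l\<close>, using
      \<open>1 \<le> l\<close>.\<close>
    then show "real (2 * L + 1) \<le> 7 * l" using log(2) l by simp
  qed
  have "\<bar>\<mu> - T\<bar> \<le> 2 * \<epsilon> + real (2 * L + 1) * (22 / sqrt (real n))"
    unfolding \<mu>_def T_def by (rule mean_bias[OF supp orc c nm(1) suppQ mono \<epsilon>(1) L(1)])
  also have "\<dots> \<le> 2 * (\<epsilon> * l) + (7 * l) * (22 * \<epsilon>)"
  proof -
    have "1 / \<epsilon> = sqrt (1 / \<epsilon>\<^sup>2)" using \<epsilon> by (simp add: real_sqrt_divide)
    also have "\<dots> \<le> sqrt (real n)" using n by simp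
    finally have "22 / sqrt (real n) \<le> 22 * \<epsilon>"
      using \<epsilon> nm by (simp add: field_simps)
    then show ?thesis
      using L(2) \<epsilon> l nm by (intro add_mono mult_mono mult_left_mono) auto
  qed
  finally have bias: "\<bar>\<mu> - T\<bar> \<le> 156 * (\<epsilon> * l)" by simp
  have "\<epsilon> * 1 \<le> \<epsilon> * l" using \<epsilon> l by (intro mult_left_mono) auto
  interpret binomial_distribution m \<mu>
    by unfold_locales (simp add: \<mu>_def pmf_le_1)
  have "measure_pmf.prob (binomial_pmf m \<mu>) {x. \<epsilon> \<le> \<bar>real x / real m - \<mu>\<bar>}
      \<le> 2 * exp (- 2 * real m * \<epsilon>\<^sup>2)"
    using prob_abs_ge'[OF nm(2)] \<epsilon> by simp
  also have "\<dots> \<le> 2 * exp (- 2 * l)"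
  proof -
    have "l \<le> real m * \<epsilon>\<^sup>2" using m \<epsilon> by (simp add: l_def field_simps)
    then show ?thesis by simp
  qed
  also have "\<dots> = 2 * \<epsilon>\<^sup>2"
  proof -
    have "exp (- l) = \<epsilon>" using \<epsilon> by (simp add: l_def ln_div)
    moreover have "exp (- 2 * l) = exp (- l) * exp (- l)" by (simp flip: exp_add)
    ultimately show ?thesis by (simp add: power2_eq_square)
  qed
  also have "\<dots> \<le> \<epsilon>" using \<epsilon> by (simp add: power2_eq_square)
  finally have tail: "measure_pmf.prob (binomial_pmf m \<mu>) {x. \<epsilon> \<le> \<bar>real x / real m - \<mu>\<bar>} \<le> \<epsilon>" .
  have "1 - \<epsilon> \<le> 1 - measure_pmf.prob (binomial_pmf m \<mu>) {x. \<epsilon> \<le> \<bar>real x / real m - \<mu>\<bar>}"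
    using tail by simp
  also have "\<dots> = measure_pmf.prob (binomial_pmf m \<mu>) (- {x. \<epsilon> \<le> \<bar>real x / real m - \<mu>\<bar>})"
    using measure_pmf.prob_compl[of "{x. \<epsilon> \<le> \<bar>real x / real m - \<mu>\<bar>}" "binomial_pmf m \<mu>"]
    by (simp add: Compl_eq_Diff_UNIV)
  also have "\<dots> \<le> measure_pmf.prob (binomial_pmf m \<mu>) {x. \<bar>real x / real m - T\<bar> \<le> 200 * \<epsilon> * l}"
    using bias \<open>\<epsilon> * 1 \<le> \<epsilon> * l\<close> by (intro measure_pmf.finite_measure_mono) auto
  also have "\<dots> = measure_pmf.prob (run Orc (estimator m n M Q c1 c2))
      {(S, v). S = {1..M} \<and> \<bar>v - T\<bar> \<le> 200 * \<epsilon> * l}"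
  proof -
    have "run Orc (estimator m n M Q c1 c2) =
        map_pmf (\<lambda>Z. ({1..M}, real Z / real m)) (binomial_pmf m \<mu>)"
      unfolding estimator_def run_bind_alg run_tally \<mu>_def by (simp add: map_pmf_def)
    then show ?thesis by (simp add: vimage_def)
  qed
  finally show ?thesis unfolding T_def l_def .
qed

text \<open>
  As \<open>\<epsilon>\<close> tends to 1 both the query budget and the permitted error tend to 0, while the required
  success probability is only \<open>1 - \<epsilon>\<close>: a uniformly random grid point then succeeds without queries.
\<close>

definition guess :: "real \<Rightarrow> nat \<Rightarrow> (nat set \<times> real) cond_alg" where
  "guess \<epsilon> M = (let m = nat \<lfloor>1 / (1 - \<epsilon>)\<rfloor> in
     Draw (map_pmf (\<lambda>j. Return ({1..M}, real j / real m)) (pmf_of_set {..<m})))"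

text \<open>Rounding \<open>1 / (1 - \<epsilon>)\<close> down to \<open>m\<close> gives each grid
  point probability at least \<open>1 - \<epsilon>\<close>. It loses at most a factor 2, so the
  spacing is at most \<open>2 * (1 - \<epsilon>) \<le> 2 * ln (1 / \<epsilon>)\<close>.\<close>

lemma guess_accurate:
  assumes \<epsilon>: "0 < \<epsilon>" "\<epsilon> < 1" and T: "T \<in> {0..1}"
  shows "measure_pmf.prob (run Orc (guess \<epsilon> M))
      {(S, v). S = {1..M} \<and> \<bar>v - T\<bar> \<le> 2 * ln (1 / \<epsilon>)} \<ge> 1 - \<epsilon>"
proof -
  define m where "m = nat \<lfloor>1 / (1 - \<epsilon>)\<rfloor>"
  have "1 \<le> 1 / (1 - \<epsilon>)" using \<epsilon> by simp
  then have "1 \<le> \<lfloor>1 / (1 - \<epsilon>)\<rfloor>" by (simp add: le_floor_iff)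
  then have m: "1 \<le> real m" "real m \<le> 1 / (1 - \<epsilon>)" "1 / (1 - \<epsilon>) \<le> real m + 1"
    unfolding m_def by linarith+
  then have "1 / (1 - \<epsilon>) \<le> 2 * real m" by linarith
  then have m_inv: "1 - \<epsilon> \<le> 1 / real m" "1 / real m \<le> 2 * (1 - \<epsilon>)"
    using m \<epsilon> by (simp_all add: field_simps)
  \<comment> \<open>The minimum handles \<open>T = 1\<close>, where rounding down gives
    \<open>m\<close>, just outside the grid.\<close>
  define j where "j = min (nat \<lfloor>T * real m\<rfloor>) (m - 1)"
  have j: "j < m" using m by (auto simp: j_def)
  have "T * real m \<le> real m" using T by (intro mult_left_le_one_le) auto
  then have "real j \<le> T * real m" "T * real m \<le> real j + 1"
    using T m by (auto simp: j_def min_def of_nat_diff floor_le_iff le_floor_iff) linarith+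
  then have "\<bar>(real j - T * real m) / real m\<bar> \<le> 1 / real m"
    unfolding abs_divide abs_of_nat by (intro divide_right_mono) (auto simp: abs_le_iff)
  then have "\<bar>real j / real m - T\<bar> \<le> 1 / real m"
    using m by (simp add: diff_divide_distrib)
  also have "\<dots> \<le> 2 * ln (1 / \<epsilon>)"
    using m_inv ln_le_minus_one[of \<epsilon>] \<epsilon> by (simp add: ln_div)
  finally have close: "\<bar>real j / real m - T\<bar> \<le> 2 * ln (1 / \<epsilon>)" .
  have "1 - \<epsilon> \<le> measure_pmf.prob (pmf_of_set {..<m}) {j}"
    using j m_inv by (subst measure_pmf_of_set) auto
  also have "\<dots> \<le> measure_pmf.prob (pmf_of_set {..<m}) {j. \<bar>real j / real m - T\<bar> \<le> 2 * ln (1 / \<epsilon>)}"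
    using close by (intro measure_pmf.finite_measure_mono) auto
  also have "\<dots> = measure_pmf.prob (run Orc (guess \<epsilon> M))
      {(S, v). S = {1..M} \<and> \<bar>v - T\<bar> \<le> 2 * ln (1 / \<epsilon>)}"
  proof -
    have "run Orc (guess \<epsilon> M) = map_pmf (\<lambda>j. ({1..M}, real j / real m)) (pmf_of_set {..<m})"
      unfolding guess_def Let_def m_def[symmetric] run_Draw_map by (simp add: map_pmf_def)
    then show ?thesis by (simp add: vimage_def)
  qed
  finally show ?thesis .
qed

section \<open>Choice of constants and of the algorithm\<close>

theorem theorem5p1:
  "\<exists>K > (0::real). \<exists>D > (0::real).
     \<forall>(\<epsilon>::real) (M::nat) (Pstar :: nat pmf) (c1::real) (c2::real).
       0 < \<epsilon> \<and> \<epsilon> < 1 \<and> set_pmf Pstar \<subseteq> {1..M} \<and> mono_on {1..M} (pmf Pstar) \<and>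
       c1 \<in> {\<epsilon>..1} \<and> c2 \<in> {\<epsilon>..1} \<longrightarrow>
       (\<exists>(A :: (nat set \<times> real) cond_alg) (n::nat).
          queries_within M n A \<and>
          real n \<le> K * (1 / \<epsilon>) ^ 4 * ln (1 / \<epsilon>) ^ 6 \<and>
          (\<forall>(P :: nat pmf) Orc.
             set_pmf P \<subseteq> {1..M} \<and> is_cond_oracle M P Orc \<longrightarrow>
             measure_pmf.prob (run Orc A)
               {(S, v). S \<subseteq> {1..M} \<and> measure_pmf.prob Pstar S \<ge> 1 / 3 \<and>
                  \<bar>v - (\<Sum>i\<in>S. min (c1 * pmf P i) (c2 * pmf Pstar i))\<bar> \<le> D * \<epsilon> * ln (1 / \<epsilon>)}
             \<ge> 1 - \<epsilon>))"
\<comment> \<open>\<open>12 = 2 * 3 * 2\<close>: rounding at most doubles \<open>m\<close> and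
  \<open>n\<close>, and a trial makes \<open>3 * n\<close> queries. \<open>200\<close> comes from
  \<open>estimator_accurate\<close>; for \<open>\<epsilon> > 1 / 4\<close> it also ensures
  \<open>200 * \<epsilon> \<ge> 2\<close>, as needed by \<open>guess_accurate\<close>.\<close>
proof (rule exI[of _ 12], intro conjI, simp, rule exI[of _ 200], intro conjI, simp, intro allI impI, elim conjE)
  fix \<epsilon> :: real and M :: nat and Pstar :: "nat pmf" and c1 c2 :: real
  assume \<epsilon>: "0 < \<epsilon>" "\<epsilon> < 1" and suppQ: "set_pmf Pstar \<subseteq> {1..M}"
    and mono: "mono_on {1..M} (pmf Pstar)" and c: "c1 \<in> {\<epsilon>..1}" "c2 \<in> {\<epsilon>..1}"
  have c01: "c1 \<in> {0..1}" "c2 \<in> {0..1}" using c \<epsilon> by auto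
  let ?T = "\<lambda>P S. \<Sum>i\<in>S. min (c1 * pmf P i) (c2 * pmf Pstar i)"
  let ?good = "\<lambda>P. {(S, v). S \<subseteq> {1..M} \<and> measure_pmf.prob Pstar S \<ge> 1 / 3 \<and>
    \<bar>v - ?T P S\<bar> \<le> 200 * \<epsilon> * ln (1 / \<epsilon>)}"
  have good: "1 - \<epsilon> \<le> measure_pmf.prob R (?good P)"
    if "1 - \<epsilon> \<le> measure_pmf.prob R {(S, v). S = {1..M} \<and> \<bar>v - ?T P {1..M}\<bar> \<le> b}"
      "b \<le> 200 * \<epsilon> * ln (1 / \<epsilon>)" for R P b
  proof -
    have "measure_pmf.prob Pstar {1..M} = 1"
      using sum_pmf_eq_1[OF finite_atLeastAtMost suppQ]
      by (simp only: measure_measure_pmf_finite finite_atLeastAtMost)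
    then have "{(S, v). S = {1..M} \<and> \<bar>v - ?T P {1..M}\<bar> \<le> b} \<subseteq> ?good P"
      using that(2) by auto
    then show ?thesis
      using that(1) by (elim order_trans) (auto intro: measure_pmf.finite_measure_mono)
  qed
  show "\<exists>A n. queries_within M n A \<and> real n \<le> 12 * (1 / \<epsilon>) ^ 4 * ln (1 / \<epsilon>) ^ 6 \<and>
      (\<forall>P Orc. set_pmf P \<subseteq> {1..M} \<and> is_cond_oracle M P Orc \<longrightarrow>
        measure_pmf.prob (run Orc A) (?good P) \<ge> 1 - \<epsilon>)"
  proof (cases "\<epsilon> \<le> 1 / 4")
    case True
    define l where "l = ln (1 / \<epsilon>)"
    have "exp 1 \<le> (4 :: real)" using exp_le by linarith
    also have "4 \<le> 1 / \<epsilon>" using True \<epsilon> by (simp add: field_simps)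
    finally have l: "1 \<le> l" using \<epsilon> by (simp add: l_def ln_ge_iff)
    define n m where "n = nat \<lceil>1 / \<epsilon>\<^sup>2\<rceil>" and "m = nat \<lceil>l / \<epsilon>\<^sup>2\<rceil>"
    have one: "1 \<le> 1 / \<epsilon>\<^sup>2" using \<epsilon> by (simp add: power_le_one)
    also have "1 / \<epsilon>\<^sup>2 \<le> l / \<epsilon>\<^sup>2" using l by (intro divide_right_mono) auto
    finally have one': "1 \<le> l / \<epsilon>\<^sup>2" .
    have n: "1 / \<epsilon>\<^sup>2 \<le> real n" "real n \<le> 2 * (1 / \<epsilon>\<^sup>2)"
      using one unfolding n_def by linarith+
    have m: "l / \<epsilon>\<^sup>2 \<le> real m" "real m \<le> 2 * (l / \<epsilon>\<^sup>2)"
      using one' unfolding m_def by linarith+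
    have "real (m * (3 * n)) \<le> 2 * (l / \<epsilon>\<^sup>2) * (3 * (2 * (1 / \<epsilon>\<^sup>2)))"
      unfolding of_nat_mult of_nat_numeral
      using n m one one' by (intro mult_mono mult_left_mono) auto
    also have "\<dots> = 12 * (1 / \<epsilon>) ^ 4 * l ^ 1"
      using \<epsilon> by (simp add: field_simps flip: power_add)
    \<comment> \<open>Only one logarithmic factor is spent; \<open>1 \<le> l\<close> lifts it to the
      stated power.\<close>
    also have "\<dots> \<le> 12 * (1 / \<epsilon>) ^ 4 * l ^ 6"
      using l \<epsilon> by (intro mult_left_mono power_increasing) auto
    finally have "real (m * (3 * n)) \<le> 12 * (1 / \<epsilon>) ^ 4 * l ^ 6" .
    then show ?thesis
      using queries_within_estimator[OF suppQ]
        good[OF estimator_accurate[OF \<epsilon>(1) True suppQ mono _ _ c01 n(1) m(1)[unfolded l_def]]]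
      unfolding l_def by (intro exI[of _ "estimator m n M Pstar c1 c2"] exI[of _ "m * (3 * n)"]) auto
  next
    case False
    have l0: "ln (1 / \<epsilon>) \<ge> 0" using \<epsilon> by simp
    have "2 * ln (1 / \<epsilon>) \<le> (200 * \<epsilon>) * ln (1 / \<epsilon>)"
      using False l0 by (intro mult_right_mono) auto
    moreover have "?T P {1..M} \<in> {0..1}" for P
    proof -
      have "?T P {1..M} \<le> (\<Sum>i\<in>{1..M}. pmf P i)"
        using c01 by (intro sum_mono) (auto simp: min_le_iff_disj intro: mult_left_le_one_le)
      also have "\<dots> \<le> 1" by (simp flip: measure_measure_pmf_finite)
      finally show ?thesis using c01 by (auto intro: sum_nonneg)
    qed
    moreover have "queries_within M 0 (guess \<epsilon> M)"
      unfolding guess_def Let_def by (rule queries_within.intros(2)) (auto intro: queries_within.intros)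
    ultimately show ?thesis
      using \<epsilon> l0 good[OF guess_accurate[OF \<epsilon>]]
      by (intro exI[of _ "guess \<epsilon> M"] exI[of _ 0]) auto
  qed
qed

end
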